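(* Let $\Delta$ be a semi-regular right-angled building of type $(W,S)$ and let $U$ be its universal group with respect to transitive permutation groups $(G^s)_{s\in S}$. Let $J\subseteq S$, let $\mathcal R$ be a residue of type $J$ in $\Delta$, and let $g\in U(\mathcal R)$. Then $g$ extends to an element $\widetilde g\in U$.
   Context: A Coxeter system $(W,S)$ is right-angled if for all distinct $s,t\in S$ the order of $st$ is $2$ or $\infty$. $\Delta$ is the unique building of type $(W,S)$ in which every $s$-panel has exactly $q_s$ chambers, for given cardinals $q_s\ge2$ $(s\in S)$. $\mathrm{Ch}(\Delta)$ is its set of chambers, $\delta$ its $W$-valued Weyl distance. Distinct chambers $c,d$ are $s$-adjacent if $\delta(c,d)=s$; $s$-panels are the classes of "equal or $s$-adjacent", and $\mathcal P_{s,c}$ is the $s$-panel containing $c$. A residue of type $J\subseteq S$ is a connected component of the graph on chambers keeping only edges with labels in $J$; it is itself a right-angled building of type $(\langle J\rangle,J)$. $\mathrm{Aut}(\cdot)$ denotes the group of type-preserving automorphisms of a building. Let $|Y_s|=q_s$. A legal $s$-coloring is a map $h_s\colon\mathrm{Ch}(\Delta)\to Y_s$ which is bijective on every $s$-panel and constant on every residue of type $S\setminus\{s\}$. Given legal $s$-colorings $h_s$ and transitive groups $G^s\le\mathrm{Sym}(Y_s)$ for all $s\in S$, define for any residue $\mathcal R$ of type $J$ $$U(\mathcal R)=\{g\in\mathrm{Aut}(\mathcal R)\mid (h_s|_{\mathcal P_{s,gc}})\circ g\circ(h_s|_{\mathcal P_{s,c}})^{-1}\in G^s\text{ for all }s\in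 J,\ c\in\mathrm{Ch}(\mathcal R)\},$$ and let $U=U(\Delta)$ (the case $J=S$). *)

theory Defs
  imports "HOL-Algebra.Algebra"
begin

unbundle cardinal_syntax

section \<open>Right-angled Coxeter systems\<close>

definition word_prod :: "('w, 'm) monoid_scheme \<Rightarrow> 'w list \<Rightarrow> 'w" where
  "word_prod W u = foldr (\<otimes>\<^bsub>W\<^esub>) u \<one>\<^bsub>W\<^esub>"

text \<open>
  The congruence on words over \<open>S\<close> generated by the Coxeter relators
  \<open>(s t)\<^sup>m = 1\<close>, where \<open>m\<close> is the order of \<open>s t\<close> in \<open>W\<close>. The library's \<^const>\<open>group.ord\<close>
  is \<open>0\<close> for elements of infinite order, in which case the relator is the empty word.
  The case \<open>s = t\<close> has \<open>m = 1\<close> and gives the relator \<open>s s\<close>; hence formal inverses are not needed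
  and the quotient is the group presented by these relators.
\<close>

inductive coxeter_equiv :: "('w, 'm) monoid_scheme \<Rightarrow> 'w set \<Rightarrow> 'w list \<Rightarrow> 'w list \<Rightarrow> bool"
  for W :: "('w, 'm) monoid_scheme" and S :: "'w set" where
  relator: "\<lbrakk>s \<in> S; t \<in> S; u \<in> lists S; v \<in> lists S\<rbrakk> \<Longrightarrow>
      coxeter_equiv W S (u @ concat (replicate (group.ord W (s \<otimes>\<^bsub>W\<^esub> t)) [s, t]) @ v) (u @ v)"
| refl: "u \<in> lists S \<Longrightarrow> coxeter_equiv W S u u"
| sym: "coxeter_equiv W S u v \<Longrightarrow> coxeter_equiv W S v u"
| trans: "\<lbrakk>coxeter_equiv W S u v; coxeter_equiv W S v w\<rbrakk> \<Longrightarrow> coxeter_equiv W S u w"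

locale coxeter_system = group W for W :: "('w, 'm) monoid_scheme" (structure) +
  fixes S :: "'w set"
  assumes generators_closed: "S \<subseteq> carrier W"
    and involution: "s \<in> S \<Longrightarrow> ord s = 2"
    and generates: "generate W S = carrier W"
    and presentation:
      "\<lbrakk>u \<in> lists S; v \<in> lists S\<rbrakk> \<Longrightarrow> word_prod W u = word_prod W v \<longleftrightarrow> coxeter_equiv W S u v"

locale right_angled_coxeter_system = coxeter_system +
  assumes right_angled: "\<lbrakk>s \<in> S; t \<in> S; s \<noteq> t\<rbrakk> \<Longrightarrow> ord (s \<otimes> t) = 2 \<or> ord (s \<otimes> t) = 0"

definition word_length :: "('w, 'm) monoid_scheme \<Rightarrow> 'w set \<Rightarrow> 'w \<Rightarrow> nat" where
  "word_length W S w = (LEAST n. \<exists>u \<in> lists S. length u = n \<and> word_prod W u = w)"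

section \<open>Buildings\<close>

text \<open>
  Buildings as \<open>W\<close>-metric spaces (Abramenko--Brown): \<open>C\<close> is the set of chambers and \<open>\<delta>\<close> the
  Weyl distance.
\<close>

locale building = coxeter_system W S for W :: "('w, 'm) monoid_scheme" (structure) and S +
  fixes C :: "'c set" and \<delta> :: "'c \<Rightarrow> 'c \<Rightarrow> 'w"
  assumes chambers_nonempty: "C \<noteq> {}"
    and dist_closed: "\<lbrakk>c \<in> C; d \<in> C\<rbrakk> \<Longrightarrow> \<delta> c d \<in> carrier W"
    and WD1: "\<lbrakk>c \<in> C; d \<in> C\<rbrakk> \<Longrightarrow> \<delta> c d = \<one> \<longleftrightarrow> c = d"
    and WD2: "\<lbrakk>c \<in> C; d \<in> C; c' \<in> C; s \<in> S; \<delta> c' c = s\<rbrakk> \<Longrightarrow>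
        \<delta> c' d \<in> {s \<otimes> \<delta> c d, \<delta> c d} \<and>
        (word_length W S (s \<otimes> \<delta> c d) = word_length W S (\<delta> c d) + 1 \<longrightarrow> \<delta> c' d = s \<otimes> \<delta> c d)"
    and WD3: "\<lbrakk>c \<in> C; d \<in> C; s \<in> S\<rbrakk> \<Longrightarrow> \<exists>c' \<in> C. \<delta> c' c = s \<and> \<delta> c' d = s \<otimes> \<delta> c d"

locale right_angled_building = building W S C \<delta> + right_angled_coxeter_system W S
  for W :: "('w, 'm) monoid_scheme" (structure) and S and C :: "'c set" and \<delta>

definition adjacent :: "('c \<Rightarrow> 'c \<Rightarrow> 'w) \<Rightarrow> 'w \<Rightarrow> 'c \<Rightarrow> 'c \<Rightarrow> bool" where
  "adjacent \<delta> s c d \<longleftrightarrow> c \<noteq> d \<and> \<delta> c d = s"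

definition panel :: "'c set \<Rightarrow> ('c \<Rightarrow> 'c \<Rightarrow> 'w) \<Rightarrow> 'w \<Rightarrow> 'c \<Rightarrow> 'c set" where
  "panel C \<delta> s c = {d \<in> C. c = d \<or> adjacent \<delta> s c d}"

definition residue :: "'c set \<Rightarrow> ('c \<Rightarrow> 'c \<Rightarrow> 'w) \<Rightarrow> 'w set \<Rightarrow> 'c set \<Rightarrow> bool" where
  "residue C \<delta> J R \<longleftrightarrow>
    (\<exists>c \<in> C. R = {(d, e). d \<in> C \<and> e \<in> C \<and> (\<exists>s \<in> J. adjacent \<delta> s d e)}\<^sup>* `` {c})"

locale semi_regular_right_angled_building = right_angled_building W S C \<delta>
  for W :: "('w, 'm) monoid_scheme" (structure) and S and C :: "'c set" and \<delta> +
  fixes q :: "'w \<Rightarrow> 'k rel"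
  assumes cardinal: "s \<in> S \<Longrightarrow> Card_order (q s)"
    and at_least_two: "s \<in> S \<Longrightarrow> ctwo \<le>o q s"
    and panel_card: "\<lbrakk>s \<in> S; c \<in> C\<rbrakk> \<Longrightarrow> |panel C \<delta> s c| =o q s"

text \<open>
  Type-preserving automorphisms of the chamber set \<open>R\<close> with its Weyl distance \<open>\<delta>\<close>; for a residue
  of type \<open>J\<close>, the restriction of \<open>\<delta>\<close> to \<open>R\<close> is its Weyl distance as a building of type
  \<open>(\<langle>J\<rangle>, J)\<close>. As everywhere in \<^const>\<open>BijGroup\<close>, permutations of \<open>R\<close> are extensional functions,
  that is, \<^const>\<open>undefined\<close> outside \<open>R\<close>.
\<close>

definition building_aut :: "('c \<Rightarrow> 'c \<Rightarrow> 'w) \<Rightarrow> 'c set \<Rightarrow> ('c \<Rightarrow> 'c) set" where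
  "building_aut \<delta> R = {g \<in> Bij R. \<forall>c \<in> R. \<forall>d \<in> R. \<delta> (g c) (g d) = \<delta> c d}"

section \<open>Colourings and universal groups\<close>

definition legal_colouring ::
    "'w set \<Rightarrow> 'c set \<Rightarrow> ('c \<Rightarrow> 'c \<Rightarrow> 'w) \<Rightarrow> 'w \<Rightarrow> 'y set \<Rightarrow> ('c \<Rightarrow> 'y) \<Rightarrow> bool" where
  "legal_colouring S C \<delta> s Ys hs \<longleftrightarrow>
    hs \<in> C \<rightarrow> Ys \<and>
    (\<forall>c \<in> C. bij_betw hs (panel C \<delta> s c) Ys) \<and>
    (\<forall>R. residue C \<delta> (S - {s}) R \<longrightarrow> (\<forall>c \<in> R. \<forall>d \<in> R. hs c = hs d))"

definition transitive_perm_group :: "'y set \<Rightarrow> ('y \<Rightarrow> 'y) set \<Rightarrow> bool" where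
  "transitive_perm_group Y H \<longleftrightarrow>
    subgroup H (BijGroup Y) \<and> (\<forall>x \<in> Y. \<forall>y \<in> Y. \<exists>\<pi> \<in> H. \<pi> x = y)"

text \<open>
  The local action of \<open>g\<close> at the \<open>s\<close>-panel of \<open>c\<close>. The restriction of \<open>h\<^sub>s\<close> to the panel of \<open>g c\<close>
  is left implicit, since an automorphism of a residue of type \<open>J\<close> maps the \<open>s\<close>-panel of \<open>c\<close> to
  that of \<open>g c\<close> whenever \<open>s \<in> J\<close>.
\<close>

definition local_action ::
    "'c set \<Rightarrow> ('c \<Rightarrow> 'c \<Rightarrow> 'w) \<Rightarrow> ('w \<Rightarrow> 'y set) \<Rightarrow> ('w \<Rightarrow> 'c \<Rightarrow> 'y) \<Rightarrow>
      ('c \<Rightarrow> 'c) \<Rightarrow> 'w \<Rightarrow> 'c \<Rightarrow> 'y \<Rightarrow> 'y" where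
  "local_action C \<delta> Y h g s c =
    restrict (h s \<circ> g \<circ> inv_into (panel C \<delta> s c) (h s)) (Y s)"

definition universal_group ::
    "'c set \<Rightarrow> ('c \<Rightarrow> 'c \<Rightarrow> 'w) \<Rightarrow> ('w \<Rightarrow> 'y set) \<Rightarrow> ('w \<Rightarrow> 'c \<Rightarrow> 'y) \<Rightarrow>
      ('w \<Rightarrow> ('y \<Rightarrow> 'y) set) \<Rightarrow> 'w set \<Rightarrow> 'c set \<Rightarrow> ('c \<Rightarrow> 'c) set" where
  "universal_group C \<delta> Y h G J R =
    {g \<in> building_aut \<delta> R. \<forall>s \<in> J. \<forall>c \<in> R. local_action C \<delta> Y h g s c \<in> G s}"

end

theory Submission
  imports Defs
begin

text \<open>
  A legally coloured right-angled building is determined by its colours. For \<open>s \<in> S\<close> and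
  \<open>y \<in> Y s\<close> let \<open>recolour s y\<close> send a chamber to the chamber of colour \<open>y\<close> in its \<open>s\<close>-panel; by
  legality this changes the colour of type \<open>s\<close> and no other. The operators for a fixed \<open>s\<close> absorb
  each other, the operators for commuting \<open>s\<close> and \<open>t\<close> commute, and recolouring by the colour that
  the chamber already has does nothing. The building is universal with these relations: if a set
  \<open>Z\<close> carries colours and operators \<open>act s y\<close> subject to the same laws, then each point of \<open>Z\<close> with
  the colours of a base chamber is the image of that chamber under an equivariant map from the
  building to \<open>Z\<close> (\<open>universal_property\<close>). This is where right-angledness enters: two minimal
  galleries from one chamber to another differ by commutations. In local form, if two different
  neighbours of \<open>c\<close> are both closer to the base chamber, then their types commute and the two
  neighbours have a common neighbour that is closer still (\<open>closer_neighbours_square\<close>, from the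
  solution of the word problem in right-angled Coxeter groups).

  Let \<open>g\<close> be an automorphism of a residue \<open>R\<close> of type \<open>J\<close>. There are two maps to construct. One is
  the retraction \<open>\<rho>\<close> of the building onto \<open>R\<close> that ignores all steps of type outside \<open>J\<close>. It is not
  the gate projection; \<open>\<rho> c\<close> is the chamber of \<open>R\<close> with the same colours of type in \<open>J\<close> that is
  reached by the \<open>J\<close>-steps of any gallery from \<open>R\<close> to \<open>c\<close>. The other is the extension \<open>g'\<close>, which
  performs a step of type in \<open>J\<close> at \<open>c\<close> with the local action of \<open>g\<close> at \<open>\<rho> c\<close>, and a step of
  another type without any change of colour. The laws hold for the pair \<open>(\<rho>, g')\<close>, so
  one application of the universal property, with \<open>Z\<close> a set of pairs, yields both
  (\<open>extend_residue_automorphism\<close>). A starting pair with the correct colours exists because the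
  colours of type outside \<open>J\<close> are constant on \<open>R\<close>, so that \<open>g\<close> preserves them. Every local action of
  \<open>g'\<close> is then either a local action of \<open>g\<close> or an identity map, hence lies in the prescribed group.
\<close>

section \<open>Reduced words up to commutation\<close>

text \<open>
  Words are considered modulo exchanging adjacent independent letters, that is, as traces. Adding
  the rule that two equal letters cancel gives the right-angled Coxeter group, and a word is
  reduced in that group if and only if no cancellation is possible after exchanges.
\<close>

locale independence =
  fixes I :: "'a \<Rightarrow> 'a \<Rightarrow> bool"
  assumes irreflexive: "\<not> I a a"
    and symmetric: "I a b \<Longrightarrow> I b a"
begin

text \<open>
  The letter \<open>s\<close> can be moved to the front of the word by exchanges.
\<close>

primrec initial :: "'a \<Rightarrow> 'a list \<Rightarrow> bool" where
  "initial s [] \<longleftrightarrow> False"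
| "initial s (x # u) \<longleftrightarrow> x = s \<or> (I s x \<and> initial s u)"

primrec reduced :: "'a list \<Rightarrow> bool" where
  "reduced [] \<longleftrightarrow> True"
| "reduced (s # u) \<longleftrightarrow> \<not> initial s u \<and> reduced u"

definition premult :: "'a \<Rightarrow> 'a list \<Rightarrow> 'a list" where
  "premult s u = (if initial s u then remove1 s u else s # u)"

text \<open>
  Equality of traces, expressed by the projections to all pairs of dependent letters (including
  the pairs of equal letters). Compared with the closure of the exchange steps, this form makes it
  immediate that removing or adding a letter respects the equivalence.
\<close>

definition trace_eq :: "'a list \<Rightarrow> 'a list \<Rightarrow> bool" where
  "trace_eq u v \<longleftrightarrow> length u = length v \<and>
    (\<forall>a b. \<not> I a b \<longrightarrow> filter (\<lambda>x. x = a \<or> x = b) u = filter (\<lambda>x. x = a \<or> x = b) v)"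

lemma trace_eq_refl: "trace_eq u u"
  by (simp add: trace_eq_def)

lemma trace_eq_sym: "trace_eq u v \<Longrightarrow> trace_eq v u"
  by (simp add: trace_eq_def)

lemma trace_eq_trans: "trace_eq u v \<Longrightarrow> trace_eq v w \<Longrightarrow> trace_eq u w"
  by (simp add: trace_eq_def)

lemma initial_in_set: "initial s u \<Longrightarrow> s \<in> set u"
  by (induction u) auto

lemma initial_iff_projections:
  "initial s u \<longleftrightarrow>
    s \<in> set u \<and> (\<forall>t. \<not> I s t \<longrightarrow> hd (filter (\<lambda>x. x = s \<or> x = t) u) = s)"
proof (induction u)
  case (Cons x u)
  show ?case
  proof (cases "x = s")
    case False
    show ?thesis
    proof (cases "I s x")
      case True
      have "filter (\<lambda>z. z = s \<or> z = t) (x # u) = filter (\<lambda>z. z = s \<or> z = t) u"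
        if "\<not> I s t" for t
        using that True False by auto
      then show ?thesis
        using Cons True False by auto
    next
      case dependent: False
      then have "hd (filter (\<lambda>z. z = s \<or> z = x) (x # u)) \<noteq> s"
        using False by simp
      then show ?thesis
        using dependent False by auto
    qed
  qed auto
qed simp

lemma initial_cong:
  assumes "trace_eq u v" shows "initial s u \<longleftrightarrow> initial s v"
proof -
  have proj: "filter (\<lambda>x. x = s \<or> x = t) u = filter (\<lambda>x. x = s \<or> x = t) v" if "\<not> I s t" for t
    using assms that by (simp add: trace_eq_def)
  have "s \<in> set u \<longleftrightarrow> s \<in> set (filter (\<lambda>x. x = s \<or> x = s) u)" by auto
  also have "\<dots> \<longleftrightarrow> s \<in> set v"
    unfolding proj[OF irreflexive] by auto
  finally show ?thesis
    using proj by (auto simp: initial_iff_projections)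
qed

lemma premult_cong:
  assumes "trace_eq u v" shows "trace_eq (premult s u) (premult s v)"
  using assms initial_cong[OF assms, of s] initial_in_set[of s u] initial_in_set[of s v]
  by (auto simp: trace_eq_def premult_def length_remove1 filter_remove1)

lemma initial_remove1: "I x s \<Longrightarrow> initial x (remove1 s u) \<longleftrightarrow> initial x u"
  by (induction u) (auto simp: irreflexive)

lemma initial_premult: "I x s \<Longrightarrow> initial x (premult s u) \<longleftrightarrow> initial x u"
  by (auto simp: premult_def initial_remove1 irreflexive)

text \<open>
  The first letter \<open>x\<close> of \<open>u\<close> stays uncancellable when an independent \<open>s\<close> behind it is removed,
  since \<open>s\<close> does not obstruct moving another \<open>x\<close> to the front.
\<close>

lemma reduced_remove1:
  assumes "reduced u" "initial s u"
  shows "reduced (remove1 s u) \<and> \<not> initial s (remove1 s u)"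
  using assms
proof (induction u)
  case (Cons x u)
  then show ?case
    using initial_remove1[OF symmetric, of s x u] by auto
qed simp

lemma reduced_premult: "reduced u \<Longrightarrow> reduced (premult s u)"
  by (simp add: premult_def reduced_remove1)

lemma Cons_remove1_trace_eq:
  assumes "initial s u" shows "trace_eq (s # remove1 s u) u"
proof -
  have "filter (\<lambda>x. x = a \<or> x = b) (s # remove1 s u) = filter (\<lambda>x. x = a \<or> x = b) u"
    if "\<not> I a b" for a b
    using assms
  proof (induction u)
    case (Cons x u)
    then show ?case using that symmetric by (cases "x = s") (auto simp: irreflexive)
  qed simp
  moreover have "length (s # remove1 s u) = length u"
    using initial_in_set[OF assms] length_pos_if_in_set[of s u] by (simp add: length_remove1)
  ultimately show ?thesis by (simp add: trace_eq_def)
qed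

text \<open>
  With \<open>premult_commute\<close> this says that the letters act on reduced traces with the relations of
  the right-angled Coxeter group. The word \<open>s s\<close> shows that reducedness is essential: both
  multiplications by \<open>s\<close> would cancel.
\<close>

lemma premult_involution:
  assumes "reduced u" shows "trace_eq (premult s (premult s u)) u"
proof (cases "initial s u")
  case True
  then show ?thesis
    using reduced_remove1[OF assms True] Cons_remove1_trace_eq[OF True] by (simp add: premult_def)
next
  case False
  then show ?thesis by (simp add: premult_def trace_eq_refl)
qed

lemma premult_commute:
  assumes "I s t" shows "trace_eq (premult s (premult t u)) (premult t (premult s u))"
proof -
  have "s \<noteq> t" using assms irreflexive by auto
  moreover have "trace_eq (s # t # u) (t # s # u)"
    using assms symmetric by (auto simp: trace_eq_def)
  ultimately show ?thesis
    using initial_premult[OF assms, of u] initial_premult[OF symmetric[OF assms], of u]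
    by (simp add: premult_def trace_eq_refl remove1_commute split: if_splits)
qed

lemma distinct_initials_independent:
  "initial s u \<Longrightarrow> initial t u \<Longrightarrow> s \<noteq> t \<Longrightarrow> I s t"
  by (induction u) (auto intro: symmetric)

definition normalise :: "'a list \<Rightarrow> 'a list" where
  "normalise u = foldr premult u []"

lemma reduced_normalise: "reduced (normalise u)"
  by (induction u) (simp_all add: normalise_def reduced_premult)

lemma normalise_reduced: "reduced u \<Longrightarrow> normalise u = u"
  by (induction u) (simp_all add: normalise_def premult_def)

lemma length_normalise: "length (normalise u) \<le> length u"
proof (induction u)
  case (Cons x u)
  have "length (premult x v) \<le> Suc (length v)" for v
    by (auto simp: premult_def length_remove1)
  from this[of "normalise u"] show ?case
    using Cons by (simp add: normalise_def)
qed (simp add: normalise_def)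

lemma normalise_append_cong:
  "trace_eq (normalise u) (normalise v) \<Longrightarrow> trace_eq (normalise (w @ u)) (normalise (w @ v))"
  by (induction w) (simp_all add: normalise_def premult_cong)

end

section \<open>Lengths in right-angled Coxeter groups\<close>

context coxeter_system
begin

lemma generator_closed: "s \<in> S \<Longrightarrow> s \<in> carrier W"
  using generators_closed by auto

lemma generator_square: "s \<in> S \<Longrightarrow> s \<otimes> s = \<one>"
  using pow_ord_eq_1[of s] involution[of s] generator_closed[of s]
  by (simp add: numeral_2_eq_2)

lemma generator_not_one: "s \<in> S \<Longrightarrow> s \<noteq> \<one>"
  using involution[of s] by auto

lemma generator_cancel:
  "s \<in> S \<Longrightarrow> w \<in> carrier W \<Longrightarrow> s \<otimes> (s \<otimes> w) = w"
  using generator_square[of s] generator_closed[of s] by (simp add: m_assoc[symmetric])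

lemma word_prod_Nil [simp]: "word_prod W [] = \<one>"
  by (simp add: word_prod_def)

lemma word_prod_Cons [simp]: "word_prod W (s # u) = s \<otimes> word_prod W u"
  by (simp add: word_prod_def)

lemma word_prod_closed: "u \<in> lists S \<Longrightarrow> word_prod W u \<in> carrier W"
  by (induction u) (auto simp: generator_closed)

lemma word_prod_append:
  "u \<in> lists S \<Longrightarrow> v \<in> lists S \<Longrightarrow> word_prod W (u @ v) = word_prod W u \<otimes> word_prod W v"
  by (induction u) (auto simp: generator_closed word_prod_closed m_assoc)

lemma word_exists:
  assumes "w \<in> carrier W" obtains u where "u \<in> lists S" "word_prod W u = w"
proof -
  have "w \<in> generate W S" using assms generates by simp
  then have "\<exists>u \<in> lists S. word_prod W u = w"
  proof (induction rule: generate.induct)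
    case one
    show ?case by (rule bexI[of _ "[]"]) auto
  next
    case (incl s)
    then show ?case by (intro bexI[of _ "[s]"]) (auto simp: generator_closed)
  next
    case (inv s)
    then have "inv s = s"
      using generator_square generator_closed by (simp add: inv_equality)
    then show ?case using inv by (intro bexI[of _ "[s]"]) (auto simp: generator_closed)
  next
    case (eng w1 w2)
    then show ?case using word_prod_append by (metis append_in_lists_conv)
  qed
  then show thesis using that by blast
qed

end

context right_angled_coxeter_system
begin

definition commuting :: "'a \<Rightarrow> 'a \<Rightarrow> bool" where
  "commuting s t \<longleftrightarrow> s \<noteq> t \<and> s \<otimes> t = t \<otimes> s"

end

sublocale right_angled_coxeter_system \<subseteq> independence commuting
  by unfold_locales (auto simp: commuting_def)

context right_angled_coxeter_system
begin

lemma premult_closed: "s \<in> S \<Longrightarrow> u \<in> lists S \<Longrightarrow> premult s u \<in> lists S"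
  using set_remove1_subset[of s u] by (auto simp: premult_def in_lists_conv_set)

lemma word_prod_remove1:
  assumes "initial s u" "s \<in> S" "u \<in> lists S"
  shows "s \<otimes> word_prod W (remove1 s u) = word_prod W u"
  using assms
proof (induction u)
  case (Cons x u)
  have closed: "remove1 s u \<in> lists S"
    using Cons.prems set_remove1_subset[of s u] by (auto simp: in_lists_conv_set)
  show ?case
  proof (cases "x = s")
    case False
    with Cons.prems have "commuting s x" "initial s u" "x \<in> S" "u \<in> lists S"
      by auto
    moreover from this have "s \<otimes> x = x \<otimes> s"
      by (simp add: commuting_def)
    moreover note Cons.IH Cons.prems
    ultimately have "s \<otimes> (x \<otimes> word_prod W (remove1 s u)) = x \<otimes> word_prod W u"
      using closed generator_closed word_prod_closed by (metis m_assoc)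
    then show ?thesis
      using False by simp
  qed simp
qed simp

lemma word_prod_premult:
  assumes "s \<in> S" "u \<in> lists S"
  shows "word_prod W (premult s u) = s \<otimes> word_prod W u"
proof (cases "initial s u")
  case True
  have "remove1 s u \<in> lists S"
    using assms set_remove1_subset[of s u] by (auto simp: in_lists_conv_set)
  then have "s \<otimes> word_prod W u = word_prod W (remove1 s u)"
    using word_prod_remove1[OF True assms] generator_cancel[OF assms(1)] word_prod_closed by metis
  then show ?thesis using True by (simp add: premult_def)
qed (simp add: premult_def)

lemma normalise_closed: "u \<in> lists S \<Longrightarrow> normalise u \<in> lists S"
  by (induction u) (auto simp: normalise_def premult_closed simp del: in_lists_conv_set)

lemma word_prod_normalise: "u \<in> lists S \<Longrightarrow> word_prod W (normalise u) = word_prod W u"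
proof (induction u)
  case (Cons x u)
  then show ?case
    using word_prod_premult[of x "normalise u"] normalise_closed[of u] by (simp add: normalise_def)
qed (simp add: normalise_def)

text \<open>
  If \<open>s t\<close> is an involution, it equals its inverse, which is \<open>t s\<close>.
\<close>

lemma commuting_if_order_two:
  assumes "s \<in> S" "t \<in> S" "s \<noteq> t" "ord (s \<otimes> t) = 2"
  shows "commuting s t"
proof -
  have closed: "s \<in> carrier W" "t \<in> carrier W" using assms generator_closed by auto
  have "(s \<otimes> t) \<otimes> (s \<otimes> t) = \<one>"
    using pow_ord_eq_1[of "s \<otimes> t"] assms closed by (simp add: numeral_2_eq_2)
  then have "inv (s \<otimes> t) = s \<otimes> t" using closed by (simp add: inv_equality)
  moreover have "inv s = s" "inv t = t"
    using assms generator_square closed by (simp_all add: inv_equality)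
  ultimately show ?thesis
    using closed assms by (simp add: commuting_def inv_mult_group)
qed

lemma normalise_relator:
  assumes "s \<in> S" "t \<in> S"
  shows "trace_eq (normalise (concat (replicate (ord (s \<otimes> t)) [s, t]) @ v)) (normalise v)"
proof -
  let ?n = "normalise v"
  have app: "normalise (a # w) = premult a (normalise w)" for a w
    by (simp add: normalise_def)
  show ?thesis
  proof (cases "s = t")
    case True
    then have "ord (s \<otimes> t) = 1"
      using assms generator_square by simp
    then show ?thesis
      using True premult_involution[OF reduced_normalise] by (simp add: app)
  next
    case False
    consider "ord (s \<otimes> t) = 0" | "ord (s \<otimes> t) = 2" using right_angled[OF assms False] by auto
    then show ?thesis
    proof cases
      case 1
      then show ?thesis by (simp add: trace_eq_refl)
    next
      case 2
      have "trace_eq (premult t (premult s (premult t ?n))) (premult s (premult t (premult t ?n)))"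
        by (rule premult_commute[OF symmetric[OF commuting_if_order_two[OF assms False 2]]])
      moreover have "trace_eq (premult s (premult t (premult t ?n))) (premult s ?n)"
        by (rule premult_cong[OF premult_involution[OF reduced_normalise]])
      ultimately have "trace_eq (premult t (premult s (premult t ?n))) (premult s ?n)"
        by (rule trace_eq_trans)
      then have "trace_eq (premult s (premult t (premult s (premult t ?n)))) (premult s (premult s ?n))"
        by (rule premult_cong)
      moreover have "trace_eq (premult s (premult s ?n)) ?n"
        by (rule premult_involution[OF reduced_normalise])
      ultimately have "trace_eq (premult s (premult t (premult s (premult t ?n)))) ?n"
        by (rule trace_eq_trans)
      then show ?thesis
        using 2 by (simp add: app numeral_2_eq_2)
    qed
  qed
qed

text \<open>
  The normal form is an invariant of the group element: reading a word letter by letter is an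
  action on reduced traces that satisfies the defining relators.
\<close>

lemma normalise_coxeter_equiv:
  "coxeter_equiv W S u v \<Longrightarrow> trace_eq (normalise u) (normalise v)"
proof (induction rule: coxeter_equiv.induct)
  case (relator s t u v)
  then show ?case by (intro normalise_append_cong normalise_relator)
next
  case (refl u)
  show ?case by (rule trace_eq_refl)
next
  case (sym u v)
  then show ?case by (simp only: trace_eq_sym)
next
  case (trans u v w)
  from trans.IH show ?case by (rule trace_eq_trans)
qed

lemma word_length_reduced:
  assumes "reduced u" "u \<in> lists S"
  shows "word_length W S (word_prod W u) = length u"
  unfolding word_length_def
proof (rule Least_equality)
  show "\<exists>v \<in> lists S. length v = length u \<and> word_prod W v = word_prod W u"
    using assms by blast
next
  fix n assume "\<exists>v \<in> lists S. length v = n \<and> word_prod W v = word_prod W u"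
  then obtain v where v: "v \<in> lists S" "length v = n" "word_prod W v = word_prod W u" by blast
  then have "trace_eq (normalise u) (normalise v)"
    using presentation assms normalise_coxeter_equiv by metis
  then show "length u \<le> n"
    using v length_normalise[of v] normalise_reduced[OF assms(1)] by (simp add: trace_eq_def)
qed

lemma reduced_word_exists:
  assumes "w \<in> carrier W"
  obtains u where "u \<in> lists S" "reduced u" "word_prod W u = w"
proof -
  obtain u where "u \<in> lists S" "word_prod W u = w" using word_exists[OF assms] .
  then show thesis
    using that[OF normalise_closed reduced_normalise] word_prod_normalise by blast
qed

lemma word_length_one: "word_length W S \<one> = 0"
  using word_length_reduced[of "[]"] by simp

lemma word_length_mult:
  assumes "s \<in> S" "u \<in> lists S" "reduced u"
  shows "word_length W S (s \<otimes> word_prod W u) = length (premult s u)"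
  using assms word_length_reduced[of "premult s u"] reduced_premult premult_closed word_prod_premult
  by simp

lemma word_length_step:
  assumes "s \<in> S" "w \<in> carrier W"
  shows "word_length W S (s \<otimes> w) = word_length W S w + 1
    \<or> word_length W S w = word_length W S (s \<otimes> w) + 1"
proof -
  obtain u where u: "u \<in> lists S" "reduced u" "word_prod W u = w"
    using reduced_word_exists[OF assms(2)] .
  have "length (premult s u) = length u + 1 \<or> length u = length (premult s u) + 1"
    using initial_in_set[of s u] length_pos_if_in_set[of s u]
    by (auto simp: premult_def length_remove1)
  then show ?thesis
    using word_length_mult[OF assms(1) u(1,2)] word_length_reduced[OF u(2,1)] u(3) by simp
qed

lemma descent_exists:
  assumes "w \<in> carrier W" "w \<noteq> \<one>"
  obtains s where "s \<in> S" "word_length W S (s \<otimes> w) < word_length W S w"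
proof -
  obtain u where u: "u \<in> lists S" "reduced u" "word_prod W u = w"
    using reduced_word_exists[OF assms(1)] .
  with assms obtain s v where "u = s # v" by (cases u) auto
  with u have "s \<in> S" "word_length W S (s \<otimes> w) < word_length W S w"
    using word_length_mult[of s u] word_length_reduced[of u] by (auto simp: premult_def)
  then show thesis using that by blast
qed

text \<open>
  Two generators that shorten \<open>w\<close> can both be moved to the front of one reduced word for \<open>w\<close>.
  Hence they commute, and they can be cancelled one after the other.
\<close>

lemma two_descents:
  assumes "w \<in> carrier W" "s \<in> S" "t \<in> S" "s \<noteq> t"
    and "word_length W S (s \<otimes> w) < word_length W S w"
    and "word_length W S (t \<otimes> w) < word_length W S w"
  shows "commuting s t"
    and "word_length W S (t \<otimes> (s \<otimes> w)) < word_length W S (s \<otimes> w)"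
proof -
  obtain u where u: "u \<in> lists S" "reduced u" "word_prod W u = w"
    using reduced_word_exists[OF assms(1)] .
  have initial: "initial r u" if "r \<in> S" "word_length W S (r \<otimes> w) < word_length W S w" for r
    using that word_length_mult[OF that(1) u(1,2)] word_length_reduced[OF u(2,1)] u(3)
    by (auto simp: premult_def split: if_splits)
  then have st: "initial s u" "initial t u" using assms by auto
  then show commuting: "commuting s t" using distinct_initials_independent assms(4) by blast
  let ?v = "premult s u"
  have v: "?v \<in> lists S" "reduced ?v" "word_prod W ?v = s \<otimes> w"
    using premult_closed reduced_premult word_prod_premult u assms(2) by auto
  have "initial t ?v" using initial_premult[OF symmetric[OF commuting]] st by blast
  then have "length (premult t ?v) < length ?v"
    using initial_in_set[of t ?v] length_pos_if_in_set[of t ?v]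
    by (simp add: premult_def[of t] length_remove1)
  then show "word_length W S (t \<otimes> (s \<otimes> w)) < word_length W S (s \<otimes> w)"
    using word_length_mult[OF assms(3) v(1,2)] word_length_reduced[OF v(2,1)] v(3) by simp
qed

end

section \<open>Adjacency and distance\<close>

context building
begin

lemma adjacent_iff:
  assumes "s \<in> S" "c \<in> C" "d \<in> C"
  shows "adjacent \<delta> s c d \<longleftrightarrow> \<delta> c d = s"
  using assms WD1[of c d] generator_not_one by (auto simp: adjacent_def)

lemma mem_panel:
  assumes "s \<in> S" "c \<in> C"
  shows "d \<in> panel C \<delta> s c \<longleftrightarrow> d \<in> C \<and> (d = c \<or> \<delta> c d = s)"
  using assms adjacent_iff by (auto simp: panel_def)

lemma dist_generator_sym:
  assumes "s \<in> S" "c \<in> C" "d \<in> C" "\<delta> c d = s"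
  shows "\<delta> d c = s"
proof -
  have "c \<noteq> d" using assms WD1[of c d] generator_not_one by auto
  then have "\<delta> d c \<noteq> \<one>" using assms WD1[of d c] by auto
  then have "s \<otimes> \<delta> d c = \<one>"
    using WD2[of d c c s] assms WD1[of c c] by auto
  then show ?thesis
    using assms generator_cancel[of s "\<delta> d c"] dist_closed[of d c] generator_closed by auto
qed

lemma dist_panel:
  assumes "s \<in> S" "c \<in> C" "d \<in> C" "b \<in> C" "\<delta> c d = s"
  shows "\<delta> d b = s \<otimes> \<delta> c b \<or> \<delta> d b = \<delta> c b"
  using WD2[of c b d s] dist_generator_sym[of s c d] assms by auto

lemma panel_sym:
  "s \<in> S \<Longrightarrow> c \<in> C \<Longrightarrow> d \<in> panel C \<delta> s c \<Longrightarrow> c \<in> panel C \<delta> s d"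
  using dist_generator_sym[of s c d] mem_panel[of s c d] mem_panel[of s d c] by auto

lemma panel_trans:
  assumes "s \<in> S" "c \<in> C" "d \<in> panel C \<delta> s c" "e \<in> panel C \<delta> s d"
  shows "e \<in> panel C \<delta> s c"
proof (cases "d = c \<or> e = d")
  case False
  then have "d \<in> C" "e \<in> C" "\<delta> c d = s" "\<delta> d e = s"
    using assms mem_panel by auto
  moreover from this have "\<delta> c e = s \<otimes> s \<or> \<delta> c e = s"
    using WD2[of d e c s] assms by auto
  ultimately show ?thesis
    using assms mem_panel WD1[of c e] generator_square by auto
qed (use assms in auto)

lemma panel_eq:
  assumes "s \<in> S" "c \<in> C" "d \<in> panel C \<delta> s c"
  shows "panel C \<delta> s d = panel C \<delta> s c"
proof -
  have "d \<in> C" using assms mem_panel by auto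
  then show ?thesis
    using assms panel_sym panel_trans by blast
qed

abbreviation dist_length :: "'c \<Rightarrow> 'c \<Rightarrow> nat" where
  "dist_length c d \<equiv> word_length W S (\<delta> c d)"

lemma dist_closer_panel:
  assumes "s \<in> S" "c \<in> C" "p \<in> C" "b \<in> C" "\<delta> c p = s" "dist_length p b < dist_length c b"
  shows "\<delta> p b = s \<otimes> \<delta> c b"
  using dist_panel[of s c p b] assms by auto

end

context right_angled_building
begin

text \<open>
  Multiplication by \<open>s\<close> always changes the length, so of \<open>c\<close> and its \<open>s\<close>-neighbour with distance
  \<open>s \<otimes> \<delta> c b\<close> to \<open>b\<close>, one has a distance that grows under multiplication by \<open>s\<close>. The second axiom for
  the Weyl distance places all other chambers of the panel above that one.
\<close>

lemma panel_gate:
  assumes "s \<in> S" "c \<in> C" "b \<in> C"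
  obtains p where "p \<in> panel C \<delta> s c"
    "\<And>d. d \<in> panel C \<delta> s c \<Longrightarrow> d \<noteq> p \<Longrightarrow> dist_length p b < dist_length d b"
proof -
  have gate: "dist_length p b < dist_length d b"
    if "p \<in> C" "word_length W S (s \<otimes> \<delta> p b) = dist_length p b + 1"
      "d \<in> panel C \<delta> s p" "d \<noteq> p" for p d
    using that WD2[of p b d s] dist_generator_sym[of s p d] mem_panel[of s p d] assms by auto
  consider "word_length W S (s \<otimes> \<delta> c b) = dist_length c b + 1"
    | "dist_length c b = word_length W S (s \<otimes> \<delta> c b) + 1"
    using word_length_step[OF assms(1) dist_closed[OF assms(2,3)]] by blast
  then show thesis
  proof cases
    case 1
    show ?thesis
      by (rule that[of c]) (use 1 gate assms mem_panel in auto)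
  next
    case 2
    obtain p where p: "p \<in> C" "\<delta> p c = s" "\<delta> p b = s \<otimes> \<delta> c b"
      using WD3[of c b s] assms by blast
    have "word_length W S (s \<otimes> \<delta> p b) = dist_length p b + 1"
      using 2 p generator_cancel[OF assms(1) dist_closed[OF assms(2,3)]] by simp
    moreover have mem: "p \<in> panel C \<delta> s c"
      using p assms mem_panel[of s c p] dist_generator_sym[of s p c] by auto
    ultimately show ?thesis
      using that[of p] gate[of p] p panel_eq[OF assms(1,2) mem] by auto
  qed
qed

lemma closer_neighbour_exists:
  assumes "c \<in> C" "b \<in> C" "c \<noteq> b"
  obtains s p where "s \<in> S" "p \<in> C" "\<delta> p c = s" "\<delta> p b = s \<otimes> \<delta> c b"
    "dist_length p b < dist_length c b"
proof -
  have "\<delta> c b \<noteq> \<one>" using assms WD1 by auto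
  then obtain s where s: "s \<in> S" "word_length W S (s \<otimes> \<delta> c b) < dist_length c b"
    using descent_exists dist_closed assms by metis
  obtain p where "p \<in> C" "\<delta> p c = s" "\<delta> p b = s \<otimes> \<delta> c b"
    using WD3[of c b s] assms s by blast
  then show thesis using that s by auto
qed

lemma chamber_induct [consumes 2, case_names base step]:
  assumes "b \<in> C" "c \<in> C" and base: "P b"
    and step: "\<And>s p d. s \<in> S \<Longrightarrow> p \<in> C \<Longrightarrow> d \<in> C \<Longrightarrow> \<delta> p d = s \<Longrightarrow> P p \<Longrightarrow> P d"
  shows "P c"
  using assms(2)
proof (induction "dist_length c b" arbitrary: c rule: less_induct)
  case less
  show ?case
  proof (cases "c = b")
    case False
    then obtain s p where "s \<in> S" "p \<in> C" "\<delta> p c = s" "dist_length p b < dist_length c b"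
      using closer_neighbour_exists[OF less.prems assms(1)] by metis
    then show ?thesis using less step by blast
  qed (use base in simp)
qed

text \<open>
  A map that respects adjacency of each type respects reduced galleries together with their type,
  and the type of a reduced gallery determines the Weyl distance of its ends.
\<close>

lemma dist_preserving:
  assumes f: "\<And>c. c \<in> C \<Longrightarrow> f c \<in> C"
    and adj: "\<And>s c d. s \<in> S \<Longrightarrow> c \<in> C \<Longrightarrow> d \<in> C \<Longrightarrow> \<delta> c d = s \<Longrightarrow> \<delta> (f c) (f d) = s"
    and "c \<in> C" "b \<in> C"
  shows "\<delta> (f c) (f b) = \<delta> c b"
  using assms(3)
proof (induction "dist_length c b" arbitrary: c rule: less_induct)
  case less
  show ?case
  proof (cases "c = b")
    case True
    then show ?thesis using WD1[of b b] WD1[of "f b" "f b"] f assms(4) by simp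
  next
    case False
    then obtain s p where p: "s \<in> S" "p \<in> C" "\<delta> p c = s" "\<delta> p b = s \<otimes> \<delta> c b"
        "dist_length p b < dist_length c b"
      using closer_neighbour_exists[OF less.prems assms(4)] by metis
    have cancel: "s \<otimes> \<delta> p b = \<delta> c b"
      using p generator_cancel dist_closed less.prems assms(4) by simp
    then have "word_length W S (s \<otimes> \<delta> p b) = dist_length p b + 1"
      using word_length_step[of s "\<delta> p b"] p dist_closed[of p b] assms(4) by auto
    moreover have "\<delta> (f p) (f b) = \<delta> p b" using less p by blast
    moreover have "\<delta> (f c) (f p) = s"
      using adj[of s p c] p less.prems f dist_generator_sym[of s "f p" "f c"] by simp
    ultimately show ?thesis
      using WD2[of "f p" "f b" "f c" s] p f less.prems assms(4) cancel by auto
  qed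
qed

end

section \<open>Coloured buildings\<close>

locale coloured_building = right_angled_building W S C \<delta>
  for W :: "('w, 'm) monoid_scheme" (structure) and S and C :: "'c set" and \<delta> +
  fixes Y :: "'w \<Rightarrow> 'y set" and h :: "'w \<Rightarrow> 'c \<Rightarrow> 'y"
  assumes colouring: "s \<in> S \<Longrightarrow> legal_colouring S C \<delta> s (Y s) (h s)"
begin

definition recolour :: "'w \<Rightarrow> 'y \<Rightarrow> 'c \<Rightarrow> 'c" where
  "recolour s y c = inv_into (panel C \<delta> s c) (h s) y"

lemma colour_bij: "s \<in> S \<Longrightarrow> c \<in> C \<Longrightarrow> bij_betw (h s) (panel C \<delta> s c) (Y s)"
  using colouring[of s] by (auto simp: legal_colouring_def)

lemma colour_closed: "s \<in> S \<Longrightarrow> c \<in> C \<Longrightarrow> h s c \<in> Y s"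
  using colouring[of s] by (auto simp: legal_colouring_def)

lemma recolour_in_panel:
  "s \<in> S \<Longrightarrow> c \<in> C \<Longrightarrow> y \<in> Y s \<Longrightarrow> recolour s y c \<in> panel C \<delta> s c"
  using colour_bij[of s c] by (auto simp: recolour_def bij_betw_def inv_into_into)

lemma recolour_closed: "s \<in> S \<Longrightarrow> c \<in> C \<Longrightarrow> y \<in> Y s \<Longrightarrow> recolour s y c \<in> C"
  using recolour_in_panel mem_panel by blast

lemma colour_recolour:
  "s \<in> S \<Longrightarrow> c \<in> C \<Longrightarrow> y \<in> Y s \<Longrightarrow> h s (recolour s y c) = y"
  using colour_bij[of s c] by (auto simp: recolour_def bij_betw_def f_inv_into_f)

lemma recolour_unique:
  "s \<in> S \<Longrightarrow> c \<in> C \<Longrightarrow> d \<in> panel C \<delta> s c \<Longrightarrow> recolour s (h s d) c = d"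
  using colour_bij[of s c] by (auto simp: recolour_def bij_betw_def)

lemma recolour_own_colour: "s \<in> S \<Longrightarrow> c \<in> C \<Longrightarrow> recolour s (h s c) c = c"
  using recolour_unique mem_panel by blast

lemma recolour_panel_cong:
  "s \<in> S \<Longrightarrow> c \<in> C \<Longrightarrow> d \<in> panel C \<delta> s c \<Longrightarrow> recolour s y d = recolour s y c"
  using panel_eq by (simp add: recolour_def)

lemma recolour_recolour:
  "s \<in> S \<Longrightarrow> c \<in> C \<Longrightarrow> y \<in> Y s \<Longrightarrow> recolour s z (recolour s y c) = recolour s z c"
  using recolour_panel_cong recolour_in_panel by blast

text \<open>
  An \<open>s\<close>-panel lies in a residue of type \<open>S - {t}\<close>, where colours of type \<open>t\<close> are constant.
\<close>

lemma colour_other_panel: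
  assumes "s \<in> S" "t \<in> S" "s \<noteq> t" "c \<in> C" "d \<in> panel C \<delta> s c"
  shows "h t d = h t c"
proof -
  let ?E = "{(d, e). d \<in> C \<and> e \<in> C \<and> (\<exists>s \<in> S - {t}. adjacent \<delta> s d e)}"
  have "residue C \<delta> (S - {t}) (?E\<^sup>* `` {c})"
    using assms by (auto simp: residue_def)
  moreover have "(c, d) \<in> ?E\<^sup>*"
  proof (cases "d = c")
    case False
    then have "(c, d) \<in> ?E" using assms by (auto simp: panel_def)
    then show ?thesis by blast
  qed simp
  ultimately show ?thesis
    using colouring[OF assms(2)] unfolding legal_colouring_def by blast
qed

lemma colour_recolour_other:
  "s \<in> S \<Longrightarrow> t \<in> S \<Longrightarrow> s \<noteq> t \<Longrightarrow> c \<in> C \<Longrightarrow> y \<in> Y s \<Longrightarrow> h t (recolour s y c) = h t c"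
  using colour_other_panel recolour_in_panel by blast

text \<open>
  When both steps really move, the chambers \<open>c\<close> and \<open>d\<close> at the ends of the gallery of type
  \<open>(s, t)\<close> have distance \<open>t s = s t\<close>, so there is also a gallery of type \<open>(t, s)\<close> from \<open>c\<close> to
  \<open>d\<close>. Its middle chamber has the \<open>t\<close>-colour of \<open>d\<close>, so it is the one obtained by recolouring in
  the other order.
\<close>

lemma recolour_commute:
  assumes "s \<in> S" "t \<in> S" "commuting s t" "c \<in> C" "y \<in> Y s" "z \<in> Y t"
  shows "recolour t z (recolour s y c) = recolour s y (recolour t z c)"
proof -
  have st: "s \<noteq> t" "s \<otimes> t = t \<otimes> s" using assms by (auto simp: commuting_def)
  let ?p = "recolour s y c"
  let ?d = "recolour t z ?p"
  have closed: "?p \<in> C" "?d \<in> C" using assms recolour_closed by auto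
  have colours: "h s ?p = y" "h t ?p = h t c" "h t ?d = z" "h s ?d = y"
    using assms st closed colour_recolour colour_recolour_other by auto
  consider "y = h s c" | "z = h t c" | "y \<noteq> h s c" "z \<noteq> h t c" by blast
  then show ?thesis
  proof cases
    case 1
    moreover have "h s (recolour t z c) = h s c"
      using assms st colour_recolour_other by auto
    ultimately show ?thesis
      using recolour_own_colour assms recolour_closed by metis
  next
    case 2
    then show ?thesis
      using colours recolour_own_colour assms closed by metis
  next
    case 3
    have cp: "\<delta> c ?p = s"
      using 3 colours assms recolour_in_panel[of s c y] mem_panel by metis
    have pd: "\<delta> ?p ?d = t"
      using 3 colours assms closed recolour_in_panel[of t ?p z] mem_panel by metis
    have "\<delta> ?d c = t \<otimes> \<delta> ?p c \<or> \<delta> ?d c = \<delta> ?p c"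
      using dist_panel[of t ?p ?d c] pd assms closed by blast
    moreover have "\<delta> ?p c = s" using dist_generator_sym cp assms closed by blast
    moreover have "\<delta> ?d c \<noteq> s"
    proof
      assume "\<delta> ?d c = s"
      then have "c \<in> panel C \<delta> s ?d" using mem_panel assms closed by blast
      then show False using colour_other_panel[of s t ?d c] assms st closed colours 3 by simp
    qed
    ultimately have dc: "\<delta> ?d c = s \<otimes> t" using st by auto
    obtain e where e: "e \<in> C" "\<delta> e ?d = s" "\<delta> e c = s \<otimes> \<delta> ?d c"
      using WD3[of ?d c s] assms closed by blast
    then have "\<delta> e c = t"
      using dc assms generator_cancel generator_closed by simp
    then have ec: "e \<in> panel C \<delta> t c"
      using e assms mem_panel dist_generator_sym by blast
    have de: "?d \<in> panel C \<delta> s e"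
      using e closed assms mem_panel by blast
    then have "h t e = z"
      using colour_other_panel[of s t e ?d] assms st e colours by simp
    then have "e = recolour t z c" using recolour_unique[OF _ _ ec] assms by simp
    then show ?thesis using recolour_unique[OF _ _ de] assms e colours by simp
  qed
qed

end

section \<open>The universal property of a coloured building\<close>

text \<open>
  The target of the universal property: a set with colours and recolouring operators that satisfy
  the laws of the chamber set, and a point whose colours agree with those of a base chamber.
\<close>

locale coloured_system = coloured_building W S C \<delta> Y h
  for W :: "('w, 'm) monoid_scheme" (structure) and S and C :: "'c set" and \<delta>
    and Y :: "'w \<Rightarrow> 'y set" and h :: "'w \<Rightarrow> 'c \<Rightarrow> 'y" +
  fixes Z :: "'x set" and act :: "'w \<Rightarrow> 'y \<Rightarrow> 'x \<Rightarrow> 'x" and col :: "'w \<Rightarrow> 'x \<Rightarrow> 'y"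
    and b :: 'c and x0 :: 'x
  assumes act_closed: "\<lbrakk>s \<in> S; y \<in> Y s; x \<in> Z\<rbrakk> \<Longrightarrow> act s y x \<in> Z"
    and col_act: "\<lbrakk>s \<in> S; y \<in> Y s; x \<in> Z\<rbrakk> \<Longrightarrow> col s (act s y x) = y"
    and col_act_other: "\<lbrakk>s \<in> S; t \<in> S; s \<noteq> t; y \<in> Y s; x \<in> Z\<rbrakk> \<Longrightarrow> col t (act s y x) = col t x"
    and act_act: "\<lbrakk>s \<in> S; y \<in> Y s; z \<in> Y s; x \<in> Z\<rbrakk> \<Longrightarrow> act s z (act s y x) = act s z x"
    and act_own_col: "\<lbrakk>s \<in> S; x \<in> Z\<rbrakk> \<Longrightarrow> act s (col s x) x = x"
    and act_commute: "\<lbrakk>s \<in> S; t \<in> S; commuting s t; y \<in> Y s; z \<in> Y t; x \<in> Z\<rbrakk> \<Longrightarrow>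
      act t z (act s y x) = act s y (act t z x)"
    and base_closed: "b \<in> C" "x0 \<in> Z"
    and base_col: "s \<in> S \<Longrightarrow> col s x0 = h s b"
begin

text \<open>
  The graph of the equivariant map, built only along steps that move away from the base chamber.
  Such steps are exactly those whose ambiguity is controlled by commutations; equivariance under
  arbitrary steps is derived afterwards.
\<close>

inductive develops :: "'c \<Rightarrow> 'x \<Rightarrow> bool" where
  base: "develops b x0"
| step: "\<lbrakk>develops c x; s \<in> S; y \<in> Y s; dist_length c b < dist_length (recolour s y c) b\<rbrakk> \<Longrightarrow>
    develops (recolour s y c) (act s y x)"

lemma develops_closed: "develops c x \<Longrightarrow> c \<in> C \<and> x \<in> Z \<and> (\<forall>s \<in> S. col s x = h s c)"
proof (induction rule: develops.induct)
  case base
  then show ?case using base_closed base_col by auto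
next
  case (step c x s y)
  then show ?case
    using recolour_closed act_closed col_act col_act_other colour_recolour colour_recolour_other
    by metis
qed

lemma develops_upward:
  assumes "develops p x" "s \<in> S" "c \<in> panel C \<delta> s p" "dist_length p b < dist_length c b"
  shows "develops c (act s (h s c) x)"
proof -
  have "p \<in> C" using develops_closed assms(1) by blast
  then have "c \<in> C" "c = recolour s (h s c) p"
    using assms mem_panel recolour_unique by auto
  then show ?thesis
    using step[OF assms(1,2), of "h s c"] colour_closed assms by simp
qed

lemma develops_exists: "c \<in> C \<Longrightarrow> \<exists>x. develops c x"
proof (induction "dist_length c b" arbitrary: c rule: less_induct)
  case less
  show ?case
  proof (cases "c = b")
    case True
    then show ?thesis using base by blast
  next
    case False
    then obtain s p where p: "s \<in> S" "p \<in> C" "\<delta> p c = s" "dist_length p b < dist_length c b"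
      using closer_neighbour_exists[OF less.prems base_closed(1)] by metis
    then obtain x where "develops p x" using less by blast
    then show ?thesis
      using develops_upward[of p x s c] p less.prems mem_panel by blast
  qed
qed

lemma develops_downward:
  assumes "develops c x" "c \<noteq> b"
  obtains s p x' where "s \<in> S" "p \<in> C" "\<delta> c p = s" "dist_length p b < dist_length c b"
    "develops p x'" "x = act s (h s c) x'"
  using assms(1)
proof cases
  case base
  then show ?thesis using assms by blast
next
  case (step p x' s y)
  have "p \<in> C" using develops_closed step by blast
  moreover have "c \<in> panel C \<delta> s p" using recolour_in_panel step \<open>p \<in> C\<close> by simp
  moreover have "c \<noteq> p" using step by auto
  ultimately have "\<delta> c p = s"
    using dist_generator_sym mem_panel step by blast
  then show ?thesis
    using that[of s p x'] step \<open>p \<in> C\<close> colour_recolour by auto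
qed

text \<open>
  The fourth corner \<open>e\<close> is the \<open>t\<close>-neighbour of \<open>p\<close> with the \<open>t\<close>-colour of \<open>r\<close>. As the operators
  of types \<open>s\<close> and \<open>t\<close> commute, it is also an \<open>s\<close>-neighbour of \<open>r\<close>. The two panels leave only the
  value \<open>t s w\<close> for its distance to the base chamber, where \<open>w\<close> is the distance of \<open>c\<close>.
\<close>

lemma closer_neighbours_square:
  assumes "c \<in> C" "p \<in> C" "r \<in> C" "s \<in> S" "t \<in> S" "s \<noteq> t" "\<delta> c p = s" "\<delta> c r = t"
    and "dist_length p b < dist_length c b" "dist_length r b < dist_length c b"
  obtains e where "commuting s t" "e \<in> C" "p \<in> panel C \<delta> t e" "r \<in> panel C \<delta> s e"
    "dist_length e b < dist_length p b" "dist_length e b < dist_length r b"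
proof -
  let ?w = "\<delta> c b"
  have w: "?w \<in> carrier W" using dist_closed assms base_closed by blast
  have pb: "\<delta> p b = s \<otimes> ?w" and rb: "\<delta> r b = t \<otimes> ?w"
    using dist_closer_panel assms base_closed by blast+
  have comm: "commuting s t"
    using two_descents(1)[OF w assms(4,5,6)] assms pb rb by simp
  have len_p: "word_length W S (t \<otimes> (s \<otimes> ?w)) < word_length W S (s \<otimes> ?w)"
    using two_descents(2)[OF w assms(4,5,6)] assms pb rb by simp
  have len_r: "word_length W S (s \<otimes> (t \<otimes> ?w)) < word_length W S (t \<otimes> ?w)"
    using two_descents(2)[OF w assms(5,4)] assms pb rb by simp
  have pc: "p \<in> panel C \<delta> s c" and rc: "r \<in> panel C \<delta> t c"
    using assms mem_panel by auto
  define e where "e = recolour t (h t r) p"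
  have ep: "e \<in> panel C \<delta> t p" and eC: "e \<in> C"
    using e_def recolour_in_panel recolour_closed colour_closed assms by auto
  have "e = recolour t (h t r) (recolour s (h s p) c)"
    using e_def recolour_unique[OF _ _ pc] assms by simp
  also have "\<dots> = recolour s (h s p) r"
    using recolour_commute[OF assms(4,5) comm] recolour_unique[OF _ _ rc] colour_closed assms
    by simp
  finally have er: "e \<in> panel C \<delta> s r"
    using recolour_in_panel colour_closed assms by simp
  have "\<delta> e b = t \<otimes> (s \<otimes> ?w) \<or> \<delta> e b = s \<otimes> ?w"
    using dist_panel[of t p e b] ep mem_panel assms base_closed pb by auto
  moreover have "\<delta> e b = s \<otimes> (t \<otimes> ?w) \<or> \<delta> e b = t \<otimes> ?w"
    using dist_panel[of s r e b] er mem_panel assms base_closed rb by auto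
  moreover have "s \<otimes> ?w \<noteq> t \<otimes> ?w"
    using assms w generator_closed by auto
  moreover have "s \<otimes> (t \<otimes> ?w) = t \<otimes> (s \<otimes> ?w)"
    using comm w assms generator_closed by (simp add: commuting_def flip: m_assoc)
  moreover have "s \<otimes> ?w \<noteq> s \<otimes> (t \<otimes> ?w)"
    using len_p \<open>s \<otimes> (t \<otimes> ?w) = t \<otimes> (s \<otimes> ?w)\<close> by auto
  ultimately have "\<delta> e b = t \<otimes> (s \<otimes> ?w)" "\<delta> e b = s \<otimes> (t \<otimes> ?w)"
    by auto
  then show thesis
    using that[OF comm eC panel_sym[OF _ _ ep] panel_sym[OF _ _ er]] len_p len_r pb rb assms
    by simp
qed

lemma closer_in_panel_unique:
  assumes "c \<in> C" "p \<in> C" "r \<in> C" "s \<in> S" "\<delta> c p = s" "\<delta> c r = s"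
    and "dist_length p b < dist_length c b" "dist_length r b < dist_length c b"
  shows "p = r"
proof -
  obtain q where q: "q \<in> panel C \<delta> s c"
    "\<And>d. d \<in> panel C \<delta> s c \<Longrightarrow> d \<noteq> q \<Longrightarrow> dist_length q b < dist_length d b"
    using panel_gate assms base_closed by metis
  have above: "\<delta> d b = s \<otimes> \<delta> q b" if "d \<in> panel C \<delta> s c" "d \<noteq> q" for d
  proof -
    have "q \<in> C" using q mem_panel assms by auto
    have "d \<in> panel C \<delta> s q" using that q panel_eq assms by metis
    then have d: "d \<in> C" "\<delta> q d = s" using mem_panel \<open>q \<in> C\<close> assms that by auto
    have "\<delta> d b = s \<otimes> \<delta> q b \<or> \<delta> d b = \<delta> q b"
      using dist_panel d \<open>q \<in> C\<close> assms base_closed by blast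
    then show ?thesis using q(2)[OF that] by auto
  qed
  have mem: "c \<in> panel C \<delta> s c" "p \<in> panel C \<delta> s c" "r \<in> panel C \<delta> s c"
    using assms mem_panel by auto
  then have "c \<noteq> q" using q(2)[of p] assms by force
  then have "\<delta> c b = s \<otimes> \<delta> q b" using above mem by blast
  then have "p = q" "r = q" using above mem assms(7,8) by (metis less_irrefl)+
  then show ?thesis by simp
qed

text \<open>
  By induction on the distance to the base chamber. Two last steps of different types are compared
  through the fourth corner of the square that they span: there, the induction hypothesis and the
  commutation law of the target give the same point.
\<close>

lemma develops_unique: "develops c x \<Longrightarrow> develops c x' \<Longrightarrow> x = x'"
proof (induction "dist_length c b" arbitrary: c x x' rule: less_induct)
  case less
  have c: "c \<in> C" using develops_closed less.prems by blast
  show ?case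
  proof (cases "c = b")
    case True
    have "y = x0" if "develops c y" for y
      using that
    proof cases
      case (step p y' s z)
      then have "dist_length p b < 0"
        using True WD1[of b b] base_closed word_length_one by simp
      then show ?thesis by simp
    qed
    then show ?thesis using less.prems by blast
  next
    case False
    obtain s p u where p: "s \<in> S" "p \<in> C" "\<delta> c p = s" "dist_length p b < dist_length c b"
      "develops p u" "x = act s (h s c) u"
      using develops_downward[OF less.prems(1) False] .
    obtain t r v where r: "t \<in> S" "r \<in> C" "\<delta> c r = t" "dist_length r b < dist_length c b"
      "develops r v" "x' = act t (h t c) v"
      using develops_downward[OF less.prems(2) False] .
    show ?thesis
    proof (cases "s = t")
      case True
      then have "p = r" using closer_in_panel_unique[of c p r s] c p r by simp
      then show ?thesis using less.hyps[OF p(4)] p r True by auto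
    next
      case neq: False
      obtain e where e: "commuting s t" "e \<in> C" "p \<in> panel C \<delta> t e" "r \<in> panel C \<delta> s e"
        "dist_length e b < dist_length p b" "dist_length e b < dist_length r b"
        using closer_neighbours_square[OF c p(2) r(2) p(1) r(1) neq p(3) r(3) p(4) r(4)] .
      obtain z where z: "develops e z" using develops_exists e(2) by blast
      have zX: "z \<in> Z" using develops_closed z by blast
      have "h t p = h t c" "h s r = h s c"
        using colour_other_panel[of s t c p] colour_other_panel[of t s c r] c p r neq mem_panel
        by auto
      then have "u = act t (h t c) z" "v = act s (h s c) z"
        using less.hyps[OF p(4) p(5) develops_upward[OF z r(1) e(3,5)]]
          less.hyps[OF r(4) r(5) develops_upward[OF z p(1) e(4,6)]] by simp_all
      then show ?thesis
        using act_commute[of s t "h s c" "h t c" z] p r e zX c colour_closed by simp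
    qed
  qed
qed

text \<open>
  For the equivariance, let \<open>p\<close> be the chamber of the panel of \<open>c\<close> nearest to the base. All other
  chambers of the panel are developed directly from \<open>p\<close>, and the absorption law reduces a step
  from \<open>c\<close> to a step from \<open>p\<close>. The agreement of colours
  settles the trivial step from \<open>p\<close> to itself.
\<close>

theorem universal_property:
  obtains f where "f b = x0" "\<And>c. c \<in> C \<Longrightarrow> f c \<in> Z"
    "\<And>s c. s \<in> S \<Longrightarrow> c \<in> C \<Longrightarrow> col s (f c) = h s c"
    "\<And>s y c. s \<in> S \<Longrightarrow> y \<in> Y s \<Longrightarrow> c \<in> C \<Longrightarrow> f (recolour s y c) = act s y (f c)"
proof -
  define f where "f c = (THE x. develops c x)" for c
  have f_eq: "f c = x" if "develops c x" for c x
    unfolding f_def using that develops_unique by blast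
  have f: "develops c (f c)" if "c \<in> C" for c
    using develops_exists[OF that] f_eq by auto
  have equivariant: "f (recolour s y c) = act s y (f c)"
    if sc: "s \<in> S" "y \<in> Y s" "c \<in> C" for s y c
  proof -
    obtain p where p: "p \<in> panel C \<delta> s c"
      "\<And>d. d \<in> panel C \<delta> s c \<Longrightarrow> d \<noteq> p \<Longrightarrow> dist_length p b < dist_length d b"
      using panel_gate[OF sc(1,3) base_closed(1)] by metis
    have pC: "p \<in> C" using p mem_panel sc by auto
    have fp: "f p \<in> Z" "col s (f p) = h s p" using develops_closed[OF f[OF pC]] sc by auto
    have from_gate: "f d = act s (h s d) (f p)" if d: "d \<in> panel C \<delta> s c" for d
    proof (cases "d = p")
      case True
      then show ?thesis using fp act_own_col[of s "f p"] \<open>s \<in> S\<close> by simp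
    next
      case False
      have "d \<in> panel C \<delta> s p" using d p panel_eq \<open>s \<in> S\<close> \<open>c \<in> C\<close> by metis
      then show ?thesis
        using f_eq[OF develops_upward[OF f[OF pC] \<open>s \<in> S\<close>]] p(2)[OF d False] by blast
    qed
    have "f (recolour s y c) = act s y (f p)"
      using from_gate[OF recolour_in_panel] colour_recolour sc by simp
    moreover have "f c = act s (h s c) (f p)"
      using from_gate[of c] mem_panel sc by simp
    ultimately show ?thesis
      using act_act colour_closed fp sc by simp
  qed
  show thesis
    by (rule that[of f])
      (use f_eq[OF base] develops_closed[OF f] equivariant in auto)
qed

end

section \<open>Extending automorphisms of residues\<close>

context coloured_building
begin

text \<open>
  The connectedness is stated with panels instead of adjacency, since this is the form in which
  the recolouring operators reach the chambers of a residue.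
\<close>

lemma residue_connected_by_panels:
  assumes "J \<subseteq> S" "residue C \<delta> J R"
  obtains c where "c \<in> R" "R \<subseteq> C"
    "\<And>s d e. s \<in> J \<Longrightarrow> d \<in> R \<Longrightarrow> e \<in> panel C \<delta> s d \<Longrightarrow> e \<in> R"
    "\<And>d. d \<in> R \<Longrightarrow> (c, d) \<in> {(d, e). d \<in> R \<and> (\<exists>s \<in> J. e \<in> panel C \<delta> s d)}\<^sup>*"
proof -
  let ?E = "{(d, e). d \<in> C \<and> e \<in> C \<and> (\<exists>s \<in> J. adjacent \<delta> s d e)}"
  obtain c where c: "c \<in> C" "R = ?E\<^sup>* `` {c}"
    using assms(2) by (auto simp: residue_def)
  have sub: "R \<subseteq> C"
  proof
    fix d assume "d \<in> R"
    then have "(c, d) \<in> ?E\<^sup>*" using c by auto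
    then show "d \<in> C" by induction (use c in auto)
  qed
  show thesis
  proof (rule that[of c])
    show "c \<in> R" using c by auto
    show "R \<subseteq> C" by (rule sub)
  next
    fix s d e assume *: "s \<in> J" "d \<in> R" "e \<in> panel C \<delta> s d"
    show "e \<in> R"
    proof (cases "e = d")
      case False
      then have "(d, e) \<in> ?E" using * sub by (auto simp: panel_def)
      moreover have "(c, d) \<in> ?E\<^sup>*" using * c by auto
      ultimately have "(c, e) \<in> ?E\<^sup>*" by (rule rtrancl_into_rtrancl[rotated])
      then show ?thesis using c by auto
    qed (use * in simp)
  next
    fix d assume "d \<in> R"
    then have "(c, d) \<in> ?E\<^sup>*" using c by auto
    then show "(c, d) \<in> {(d, e). d \<in> R \<and> (\<exists>s \<in> J. e \<in> panel C \<delta> s d)}\<^sup>*"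
    proof induction
      case (step d e)
      then have "d \<in> R" "\<exists>s \<in> J. e \<in> panel C \<delta> s d"
        using c by (auto simp: panel_def)
      then show ?case using step.IH by (auto intro: rtrancl_into_rtrancl)
    qed simp
  qed
qed

lemma automorphism_panel:
  assumes "R \<subseteq> C" "g \<in> building_aut \<delta> R" "s \<in> S" "c \<in> R" "d \<in> R" "d \<in> panel C \<delta> s c"
  shows "g d \<in> panel C \<delta> s (g c)"
proof -
  have "g c \<in> R" "g d \<in> R" "\<delta> (g c) (g d) = \<delta> c d"
    using assms by (auto simp: building_aut_def Bij_def bij_betw_def)
  then show ?thesis using assms mem_panel by (metis subsetD)
qed

text \<open>
  The map \<open>\<rho>\<close> is the retraction onto \<open>R\<close> that forgets steps of type outside \<open>J\<close>. The last two
  clauses say that the local action of \<open>g'\<close> at \<open>c\<close> is that of \<open>g\<close> at \<open>\<rho> c\<close> for types in \<open>J\<close>, and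
  trivial for other types.
\<close>

theorem extend_residue_automorphism:
  assumes "J \<subseteq> S" "residue C \<delta> J R" "g \<in> building_aut \<delta> R"
  obtains g' \<rho> where "g' \<in> building_aut \<delta> C"
    "\<And>c. c \<in> C \<Longrightarrow> \<rho> c \<in> R"
    "\<And>c. c \<in> R \<Longrightarrow> g' c = g c"
    "\<And>s y c. s \<in> J \<Longrightarrow> y \<in> Y s \<Longrightarrow> c \<in> C \<Longrightarrow>
      h s (g' (recolour s y c)) = h s (g (recolour s y (\<rho> c)))"
    "\<And>s c. s \<in> S - J \<Longrightarrow> c \<in> C \<Longrightarrow> h s (g' c) = h s c"
proof -
  obtain b where b: "b \<in> R" and RC: "R \<subseteq> C"
    and R_panel: "\<And>s d e. s \<in> J \<Longrightarrow> d \<in> R \<Longrightarrow> e \<in> panel C \<delta> s d \<Longrightarrow> e \<in> R"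
    and R_connected: "\<And>d. d \<in> R \<Longrightarrow>
      (b, d) \<in> {(d, e). d \<in> R \<and> (\<exists>s \<in> J. e \<in> panel C \<delta> s d)}\<^sup>*"
    using residue_connected_by_panels[OF assms(1,2)] by blast
  have R_induct: "P d"
    if "P b" "\<And>s d e. s \<in> J \<Longrightarrow> d \<in> R \<Longrightarrow> e \<in> panel C \<delta> s d \<Longrightarrow> P d \<Longrightarrow> P e" "d \<in> R" for P d
    using R_connected[OF that(3)] by induction (use that(1,2) in blast)+
  have JS: "s \<in> S" if "s \<in> J" for s using that assms(1) by blast
  have in_C: "c \<in> C" if "c \<in> R" for c using that RC by blast
  have R_recolour: "recolour s y r \<in> R" if "s \<in> J" "y \<in> Y s" "r \<in> R" for s y r
    using R_panel recolour_in_panel JS in_C that by blast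
  have g_bij: "bij_betw g R R" and g_dist: "\<And>c d. c \<in> R \<Longrightarrow> d \<in> R \<Longrightarrow> \<delta> (g c) (g d) = \<delta> c d"
    using assms(3) by (auto simp: building_aut_def Bij_def)
  have g_inj: "inj_on g R" using g_bij by (simp add: bij_betw_def)
  have gR: "g c \<in> R" if "c \<in> R" for c using g_bij that by (auto simp: bij_betw_def)
  have g_panel: "g (recolour s y r) \<in> panel C \<delta> s (g r)" if "s \<in> J" "y \<in> Y s" "r \<in> R" for s y r
    using automorphism_panel[OF RC assms(3)] R_recolour recolour_in_panel JS in_C that by simp
  have g_recolour: "recolour s (h s (g (recolour s y r))) (g r) = g (recolour s y r)"
    if "s \<in> J" "y \<in> Y s" "r \<in> R" for s y r
    using recolour_unique[OF _ _ g_panel[OF that]] JS in_C gR that by simp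
  have g_colour: "h s (g (recolour s y r)) \<in> Y s" if "s \<in> J" "y \<in> Y s" "r \<in> R" for s y r
    using colour_closed JS in_C gR R_recolour that by simp
  have g_colour_other: "h t (g (recolour s y r)) = h t (g r)"
    if "s \<in> J" "t \<in> S" "s \<noteq> t" "y \<in> Y s" "r \<in> R" for s t y r
    using colour_other_panel[of s t "g r"] g_panel JS in_C gR that by simp
  have R_colour: "h s c = h s b" if "c \<in> R" "s \<in> S - J" for c s
    using that(1)
  proof (rule R_induct[where P = "\<lambda>c. h s c = h s b", rotated 2])
    fix t d e assume "t \<in> J" "d \<in> R" "e \<in> panel C \<delta> t d" "h s d = h s b"
    then show "h s e = h s b"
      using colour_other_panel[of t s d e] JS in_C that(2) by force
  qed simp

  \<comment> \<open>A point \<open>(r, d)\<close> is a candidate for \<open>(\<rho> c, g' c)\<close>. The colours of \<open>c\<close> are those of \<open>r\<close> for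
    types in \<open>J\<close> and those of \<open>d\<close> for other types; the colours of \<open>d\<close> of type in \<open>J\<close> are forced
    to be those of \<open>g r\<close>.\<close>
  define Z where "Z = {(r, d). r \<in> R \<and> d \<in> C \<and> (\<forall>s \<in> J. h s d = h s (g r))}"
  define act where "act s y x = (case x of (r, d) \<Rightarrow>
    if s \<in> J then (recolour s y r, recolour s (h s (g (recolour s y r))) d)
    else (r, recolour s y d))" for s y x
  define col where "col s x = (case x of (r, d) \<Rightarrow> if s \<in> J then h s r else h s d)" for s x
  have act_J: "act s y (r, d) = (recolour s y r, recolour s (h s (g (recolour s y r))) d)"
    if "s \<in> J" for s y r d using that by (simp add: act_def)
  have act_not_J: "act s y (r, d) = (r, recolour s y d)" if "s \<notin> J" for s y r d
    using that by (simp add: act_def)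
  have col_J: "col s (r, d) = h s r" if "s \<in> J" for s r d using that by (simp add: col_def)
  have col_not_J: "col s (r, d) = h s d" if "s \<notin> J" for s r d using that by (simp add: col_def)

  interpret coloured_system W S C \<delta> Y h Z act col b "(b, g b)"
  proof
    fix s y x assume *: "s \<in> S" "y \<in> Y s" "x \<in> Z"
    obtain r d where x: "x = (r, d)" by fastforce
    have rd: "r \<in> R" "d \<in> C" "\<And>t. t \<in> J \<Longrightarrow> h t d = h t (g r)" using * x by (auto simp: Z_def)
    show "act s y x \<in> Z"
    proof (cases "s \<in> J")
      case True
      have "h t (recolour s (h s (g (recolour s y r))) d) = h t (g (recolour s y r))"
        if "t \<in> J" for t
      proof (cases "t = s")
        case eq: True
        then show ?thesis using colour_recolour * rd g_colour True by simp
      next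
        case False
        then show ?thesis
          using colour_recolour_other[of s t] g_colour_other[of s t] g_colour True * rd that JS
          by simp
      qed
      then show ?thesis
        using True x rd * R_recolour recolour_closed g_colour by (simp add: act_J Z_def)
    next
      case False
      have "h t (recolour s y d) = h t (g r)" if "t \<in> J" for t
        using colour_recolour_other[of s t d y] False that * rd JS by force
      then show ?thesis using False x rd * recolour_closed by (simp add: act_not_J Z_def)
    qed
    show "col s (act s y x) = y"
      using x rd * colour_recolour in_C by (cases "s \<in> J") (simp_all add: act_J act_not_J col_J col_not_J)
    show "act s z (act s y x) = act s z x" if "z \<in> Y s" for z
      using x rd * that recolour_recolour in_C g_colour
      by (cases "s \<in> J") (simp_all add: act_J act_not_J)
    show "col t (act s y x) = col t x" if "t \<in> S" "s \<noteq> t" for t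
      using x rd * that colour_recolour_other[of s t] in_C g_colour
      by (cases "s \<in> J"; cases "t \<in> J") (simp_all add: act_J act_not_J col_J col_not_J)
    show "act t z (act s y x) = act s y (act t z x)"
      if "t \<in> S" "commuting s t" "z \<in> Y t" for t z
    proof -
      have neq: "s \<noteq> t" using that by (simp add: commuting_def)
      have comm: "recolour t z' (recolour s y' c) = recolour s y' (recolour t z' c)"
        if "c \<in> C" "y' \<in> Y s" "z' \<in> Y t" for c y' z'
        using recolour_commute[OF *(1) \<open>t \<in> S\<close> \<open>commuting s t\<close> that] .
      show ?thesis
      proof (cases "s \<in> J \<and> t \<in> J")
        case True
        \<comment> \<open>The colour that \<open>g\<close> prescribes for an \<open>s\<close>-step is the same before and after a \<open>t\<close>-step,
          because \<open>g\<close> maps \<open>t\<close>-panels to \<open>t\<close>-panels.\<close>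
        have "h s (g (recolour s y (recolour t z r))) = h s (g (recolour s y r))"
          using comm[of r y z] g_colour_other[of t s z "recolour s y r"] True neq rd * that
            R_recolour in_C by simp
        moreover have "h t (g (recolour t z (recolour s y r))) = h t (g (recolour t z r))"
          using comm[of r y z] g_colour_other[of s t y "recolour t z r"] True neq rd * that
            R_recolour in_C by simp
        ultimately show ?thesis
          using x True comm rd * that in_C g_colour by (simp add: act_J)
      next
        case False
        then show ?thesis
          using x comm rd * that in_C g_colour
          by (cases "s \<in> J"; cases "t \<in> J") (simp_all add: act_J act_not_J)
      qed
    qed
  next
    fix s x assume *: "s \<in> S" "x \<in> Z"
    obtain r d where x: "x = (r, d)" by fastforce
    have rd: "r \<in> R" "d \<in> C" "\<And>t. t \<in> J \<Longrightarrow> h t d = h t (g r)" using * x by (auto simp: Z_def)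
    show "act s (col s x) x = x"
    proof (cases "s \<in> J")
      case True
      then have "recolour s (h s (g r)) d = d"
        using recolour_own_colour[OF *(1) rd(2)] rd(3)[OF True] by simp
      then show ?thesis
        using True x rd * recolour_own_colour in_C by (simp add: act_J col_J)
    next
      case False
      then show ?thesis using x rd * recolour_own_colour by (simp add: act_not_J col_not_J)
    qed
  next
    show "b \<in> C" "(b, g b) \<in> Z" using b in_C gR by (auto simp: Z_def)
  next
    fix s assume "s \<in> S"
    then show "col s (b, g b) = h s b"
      using R_colour[of "g b" s] gR b by (cases "s \<in> J") (simp_all add: col_J col_not_J)
  qed

  obtain f where f_base: "f b = (b, g b)" and fZ: "\<And>c. c \<in> C \<Longrightarrow> f c \<in> Z"
    and f_col: "\<And>s c. s \<in> S \<Longrightarrow> c \<in> C \<Longrightarrow> col s (f c) = h s c"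
    and f_act: "\<And>s y c. s \<in> S \<Longrightarrow> y \<in> Y s \<Longrightarrow> c \<in> C \<Longrightarrow> f (recolour s y c) = act s y (f c)"
    using universal_property by metis
  define \<rho> where "\<rho> c = fst (f c)" for c
  define e where "e c = snd (f c)" for c
  have f_eq: "f c = (\<rho> c, e c)" for c by (simp add: \<rho>_def e_def)
  have \<rho>R: "\<rho> c \<in> R" and eC: "e c \<in> C" and e_colour_J: "\<And>s. s \<in> J \<Longrightarrow> h s (e c) = h s (g (\<rho> c))"
    if "c \<in> C" for c
    using fZ[OF that] by (auto simp: f_eq Z_def)
  have e_colour: "h s (e c) = h s c" if "s \<in> S - J" "c \<in> C" for s c
    using f_col[of s c] that by (simp add: f_eq col_not_J)
  have \<rho>_colour: "h s (\<rho> c) = h s c" if "s \<in> J" "c \<in> C" for s c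
    using f_col[of s c] that JS by (simp add: f_eq col_J)
  have \<rho>_recolour: "\<rho> (recolour s y c) = recolour s y (\<rho> c)"
    and e_recolour: "e (recolour s y c) = recolour s (h s (g (recolour s y (\<rho> c)))) (e c)"
    if "s \<in> J" "y \<in> Y s" "c \<in> C" for s y c
    using f_act[of s y c] that JS by (simp_all add: f_eq act_J)
  have e_recolour_other: "e (recolour s y c) = recolour s y (e c)"
    if "s \<in> S - J" "y \<in> Y s" "c \<in> C" for s y c
    using f_act[of s y c] that by (simp add: f_eq act_not_J)

  \<comment> \<open>Inside \<open>R\<close>, the rule for steps of type in \<open>J\<close> is the one that the identity and \<open>g\<close> satisfy.\<close>
  have on_R: "f c = (c, g c)" if "c \<in> R" for c
    using that
  proof (rule R_induct[where P = "\<lambda>c. f c = (c, g c)", rotated 2])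
    fix s d d' assume *: "s \<in> J" "d \<in> R" "d' \<in> panel C \<delta> s d" "f d = (d, g d)"
    have d': "d' = recolour s (h s d') d" "h s d' \<in> Y s"
      using recolour_unique[of s d d'] * JS in_C colour_closed mem_panel by auto
    have "f (recolour s (h s d') d) = (recolour s (h s d') d, g (recolour s (h s d') d))"
      using f_act[OF _ d'(2), of d] g_recolour[OF *(1) d'(2) *(2)] * JS in_C by (simp add: act_J)
    then show "f d' = (d', g d')" using d'(1) by simp
  qed (rule f_base)

  have adj: "\<delta> (e c) (e d) = s" if "s \<in> S" "c \<in> C" "d \<in> C" "\<delta> c d = s" for s c d
  proof -
    have cd: "d \<in> panel C \<delta> s c" "c \<noteq> d"
      using that mem_panel WD1[of c d] generator_not_one by auto
    have d: "d = recolour s (h s d) c" "h s d \<in> Y s"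
      using recolour_unique[OF _ _ cd(1)] that colour_closed by auto
    have neq: "h s c \<noteq> h s d" using recolour_own_colour[of s c] d(1) cd(2) that by metis
    have "e d \<in> panel C \<delta> s (e c) \<and> h s (e c) \<noteq> h s (e d)"
    proof (cases "s \<in> J")
      case True
      let ?r = "recolour s (h s d) (\<rho> c)"
      have gr: "g ?r \<in> panel C \<delta> s (g (\<rho> c))" and gY: "h s (g ?r) \<in> Y s"
        using g_panel g_colour True d(2) \<rho>R that by auto
      have "h s ?r \<noteq> h s (\<rho> c)"
        using colour_recolour \<rho>_colour True d(2) \<rho>R in_C that neq by simp
      then have "g ?r \<noteq> g (\<rho> c)"
        using g_inj \<rho>R[OF that(2)] R_recolour[OF True d(2)] by (metis inj_onD)
      moreover have "inj_on (h s) (panel C \<delta> s (g (\<rho> c)))" "g (\<rho> c) \<in> panel C \<delta> s (g (\<rho> c))"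
        using colour_bij that gR \<rho>R in_C mem_panel by (auto simp: bij_betw_def)
      ultimately have "h s (g ?r) \<noteq> h s (g (\<rho> c))"
        using gr by (auto simp: inj_on_def)
      moreover have "e d = recolour s (h s (g ?r)) (e c)"
        using e_recolour[OF True d(2) that(2)] d(1) by simp
      ultimately show ?thesis
        using recolour_in_panel colour_recolour gY that eC e_colour_J True by simp
    next
      case False
      then have "e d = recolour s (h s d) (e c)"
        using e_recolour_other[OF _ d(2) that(2)] d(1) that by simp
      then show ?thesis
        using recolour_in_panel colour_recolour e_colour d(2) that eC neq False by simp
    qed
    then show ?thesis using mem_panel that eC by auto
  qed
  have dist: "\<delta> (e c) (e d) = \<delta> c d" if "c \<in> C" "d \<in> C" for c d
    using dist_preserving[of e] eC adj that by blast
  have inj: "inj_on e C"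
  proof (rule inj_onI)
    fix c d assume "c \<in> C" "d \<in> C" "e c = e d"
    then show "c = d" using dist[of c d] WD1[of c d] WD1[of "e c" "e d"] eC by simp
  qed
  \<comment> \<open>The image is closed under adjacency: a panel in the image is hit completely, since \<open>g\<close> maps
    the corresponding panel of \<open>R\<close> onto a panel.\<close>
  have surj: "d \<in> e ` C" if "d \<in> C" for d
    using eC[OF base_closed(1)] that
  proof (induction rule: chamber_induct)
    case base
    then show ?case using base_closed by simp
  next
    case (step s p d)
    then obtain c where c: "c \<in> C" "p = e c" by blast
    have dp: "d \<in> panel C \<delta> s (e c)" using step c mem_panel by auto
    then have d: "recolour s (h s d) (e c) = d" "h s d \<in> Y s"
      using recolour_unique[OF _ _ dp] step c colour_closed by auto
    show ?case
    proof (cases "s \<in> J")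
      case True
      let ?q = "recolour s (h s d) (g (\<rho> c))"
      have q: "?q \<in> R" "?q \<in> panel C \<delta> s (g (\<rho> c))"
        using R_recolour recolour_in_panel True d(2) gR \<rho>R c in_C step by auto
      obtain r where r: "r \<in> R" "g r = ?q" using q(1) g_bij by (metis bij_betw_imp_surj_on imageE)
      have "r \<in> panel C \<delta> s (\<rho> c)"
      proof (cases "g r = g (\<rho> c)")
        case True
        then have "r = \<rho> c" using inj_onD[OF g_inj] r \<rho>R c by blast
        then show ?thesis using mem_panel step r in_C by auto
      next
        case False
        then have "\<delta> (g (\<rho> c)) (g r) = s" using q r mem_panel step gR \<rho>R c in_C by auto
        then have "\<delta> (\<rho> c) r = s" using g_dist[OF \<rho>R[OF c(1)] r(1)] by simp
        then show ?thesis using mem_panel[of s "\<rho> c"] step(1) \<rho>R[OF c(1)] r(1) in_C by blast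
      qed
      then have "recolour s (h s r) (\<rho> c) = r" "h s r \<in> Y s"
        using recolour_unique colour_closed step \<rho>R c in_C r by auto
      moreover have "h s ?q = h s d"
        using colour_recolour d(2) step gR \<rho>R c in_C by simp
      ultimately have "e (recolour s (h s r) c) = d"
        using e_recolour[OF True, of "h s r" c] c r d by simp
      then show ?thesis
        using recolour_closed[OF step(1) c(1) \<open>h s r \<in> Y s\<close>] by (metis image_eqI)
    next
      case False
      then have "e (recolour s (h s d) c) = d" using e_recolour_other d c step by simp
      then show ?thesis using recolour_closed[OF step(1) c(1) d(2)] by (metis image_eqI)
    qed
  qed
  have "e ` C = C" using surj eC by blast
  then have "bij_betw (restrict e C) C C"
    using inj by (simp add: bij_betw_def)
  then have aut: "restrict e C \<in> building_aut \<delta> C"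
    using dist by (simp add: building_aut_def Bij_def)
  show thesis
  proof (rule that[OF aut \<rho>R])
    show "restrict e C c = g c" if "c \<in> R" for c
      using on_R[OF that] in_C[OF that] by (simp add: e_def)
  next
    fix s y c assume *: "s \<in> J" "y \<in> Y s" "c \<in> C"
    then show "h s (restrict e C (recolour s y c)) = h s (g (recolour s y (\<rho> c)))"
      using recolour_closed e_colour_J \<rho>_recolour JS by simp
  next
    show "h s (restrict e C c) = h s c" if "s \<in> S - J" "c \<in> C" for s c
      using e_colour that by simp
  qed
qed

lemma local_action_eq:
  assumes "s \<in> S" "c \<in> C"
  shows "local_action C \<delta> Y h g s c = (\<lambda>y \<in> Y s. h s (g (recolour s y c)))"
  by (auto simp: local_action_def recolour_def)

end

theorem proposition3p15:
  fixes W :: "('w, 'm) monoid_scheme" and S J :: "'w set"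
    and C R :: "'c set" and \<delta> :: "'c \<Rightarrow> 'c \<Rightarrow> 'w"
    and q :: "'w \<Rightarrow> 'k rel" and Y :: "'w \<Rightarrow> 'y set"
    and h :: "'w \<Rightarrow> 'c \<Rightarrow> 'y" and G :: "'w \<Rightarrow> ('y \<Rightarrow> 'y) set" and g :: "'c \<Rightarrow> 'c"
  assumes "semi_regular_right_angled_building W S C \<delta> q"
    and "\<And>s. s \<in> S \<Longrightarrow> |Y s| =o q s"
    and "\<And>s. s \<in> S \<Longrightarrow> legal_colouring S C \<delta> s (Y s) (h s)"
    and "\<And>s. s \<in> S \<Longrightarrow> transitive_perm_group (Y s) (G s)"
    and "J \<subseteq> S"
    and "residue C \<delta> J R"
    and "g \<in> universal_group C \<delta> Y h G J R"
  shows "\<exists>g' \<in> universal_group C \<delta> Y h G S C. \<forall>c \<in> R. g' c = g c"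
proof -
  interpret semi_regular_right_angled_building W S C \<delta> q by (rule assms(1))
  interpret coloured_building W S C \<delta> Y h
    by unfold_locales (rule assms(3))
  have g: "g \<in> building_aut \<delta> R" and g_local: "\<And>s c. s \<in> J \<Longrightarrow> c \<in> R \<Longrightarrow> local_action C \<delta> Y h g s c \<in> G s"
    using assms(7) by (auto simp: universal_group_def)
  have RC: "R \<subseteq> C" using residue_connected_by_panels[OF assms(5,6)] by blast
  show ?thesis
  proof (rule extend_residue_automorphism[OF assms(5,6) g])
    fix g' \<rho>
    assume aut: "g' \<in> building_aut \<delta> C" and \<rho>: "\<And>c. c \<in> C \<Longrightarrow> \<rho> c \<in> R"
      and extends: "\<And>c. c \<in> R \<Longrightarrow> g' c = g c"
      and in_J: "\<And>s y c. s \<in> J \<Longrightarrow> y \<in> Y s \<Longrightarrow> c \<in> C \<Longrightarrow>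
        h s (g' (recolour s y c)) = h s (g (recolour s y (\<rho> c)))"
      and not_in_J: "\<And>s c. s \<in> S - J \<Longrightarrow> c \<in> C \<Longrightarrow> h s (g' c) = h s c"
    have "local_action C \<delta> Y h g' s c \<in> G s" if sc: "s \<in> S" "c \<in> C" for s c
    proof (cases "s \<in> J")
      case True
      have "\<rho> c \<in> R" "\<rho> c \<in> C" using \<rho>[OF sc(2)] RC by auto
      then have "local_action C \<delta> Y h g' s c = local_action C \<delta> Y h g s (\<rho> c)"
        using True sc in_J by (simp add: local_action_eq cong: restrict_cong)
      then show ?thesis using g_local[OF True \<open>\<rho> c \<in> R\<close>] by simp
    next
      case False
      then have "local_action C \<delta> Y h g' s c = (\<lambda>y \<in> Y s. y)"
        using sc not_in_J recolour_closed colour_recolour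
        by (simp add: local_action_eq cong: restrict_cong)
      also have "\<dots> = \<one>\<^bsub>BijGroup (Y s)\<^esub>" by (simp add: BijGroup_def)
      also have "\<dots> \<in> G s"
        using assms(4)[OF sc(1)] subgroup.one_closed by (auto simp: transitive_perm_group_def)
      finally show ?thesis .
    qed
    then have "g' \<in> universal_group C \<delta> Y h G S C" using aut by (simp add: universal_group_def)
    then show ?thesis using extends by blast
  qed
qed

end
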